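(* Let $X=[\vec x_1\ \cdots\ \vec x_n]\in\mathbb{R}^{p\times n}$, $\sigma>0$, and let $\Lambda\in\mathbb{R}^{p\times p}$ be symmetric positive definite. For $S\subseteq\{1,\ldots,n\}$ let $X_S$ be the submatrix of $X$ with columns indexed by $S$, and define $$F(S)=\mathrm{tr}(\Lambda)-\mathrm{tr}\left((\Lambda^{-1}+\sigma^{-2}X_SX_S^T)^{-1}\right).$$ Let $s=\max_{i\in[n]}\|\vec x_i\|_2$ and $c=1+\frac{s^2}{\sigma^2}\lambda_{\max}(\Lambda)$. Then $F$ is $(1/c,c)$-weakly submodular, i.e., for all $A\subseteq B\subseteq\{1,\ldots,n\}$, $$\tfrac1c\,(F(B)-F(A))\le\sum_{i\in B\setminus A}(F(A\cup\{i\})-F(A))\quad\text{and}\quad c\,(F(B)-F(A))\ge\sum_{i\in B\setminus A}(F(B)-F(B\setminus\{i\})).$$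
   Context: This is the Bayesian A-optimal design objective for the linear model $\vec y=X^T\bm\theta+\bm\varepsilon$ with $\bm\varepsilon\sim\mathcal{N}(0,\sigma^2I)$ and prior $\bm\theta\sim\mathcal{N}(0,\Lambda)$; $\lambda_{\max}(\Lambda)$ denotes the largest eigenvalue of $\Lambda$. *)

theory Defs
  imports "HOL-Analysis.Analysis"
begin

definition sym_pos_def :: "real^'p^'p \<Rightarrow> bool" where
  "sym_pos_def A \<longleftrightarrow> transpose A = A \<and> (\<forall>v. v \<noteq> 0 \<longrightarrow> 0 < v \<bullet> (A *v v))"

definition eigenvalues :: "real^'p^'p \<Rightarrow> real set" where
  "eigenvalues A = {\<mu>. \<exists>v. v \<noteq> 0 \<and> A *v v = \<mu> *\<^sub>R v}"

definition lambda_max :: "real^'p^'p \<Rightarrow> real" where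
  "lambda_max A = Max (eigenvalues A)"

text \<open>
  The product \<open>X\<^sub>S X\<^sub>S\<^sup>T\<close>, where \<open>X\<^sub>S\<close> has the columns of \<open>X\<close> indexed by \<open>S\<close>. Matrix dimensions
  are types, so \<open>X\<^sub>S\<close> itself has no uniform type for varying (possibly empty) \<open>S\<close>; the \<open>p \<times> p\<close>
  product is therefore given entrywise. The lemma \<open>col_gram_eq_submatrix\<close> confirms that it is the
  library matrix product for every enumeration of a nonempty \<open>S\<close> by a finite type.
\<close>
definition col_gram :: "real^'n^'p \<Rightarrow> 'n set \<Rightarrow> real^'p^'p" where
  "col_gram X S = (\<chi> j k. \<Sum>i\<in>S. X $ j $ i * X $ k $ i)"

lemma col_gram_eq_submatrix:
  fixes X :: "real^'n^'p" and f :: "'m::finite \<Rightarrow> 'n"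
  assumes "bij_betw f UNIV S"
  defines "XS \<equiv> (\<chi> j m. X $ j $ f m) :: real^'m^'p"
  shows "col_gram X S = XS ** transpose XS"
  by (simp add: col_gram_def XS_def matrix_matrix_mult_def transpose_def vec_eq_iff
      sum.reindex_bij_betw[OF assms(1), symmetric])

lemma col_gram_empty: "col_gram X {} = 0"
  by (simp add: col_gram_def vec_eq_iff)

definition bayes_A_opt :: "real^'n^'p \<Rightarrow> real \<Rightarrow> real^'p^'p \<Rightarrow> 'n set \<Rightarrow> real" where
  "bayes_A_opt X \<sigma> \<Lambda> S =
     trace \<Lambda> - trace (matrix_inv (matrix_inv \<Lambda> + (1 / \<sigma>\<^sup>2) *\<^sub>R col_gram X S))"

definition weakly_submodular :: "real \<Rightarrow> real \<Rightarrow> ('n::finite set \<Rightarrow> real) \<Rightarrow> bool" where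
  "weakly_submodular a b F \<longleftrightarrow>
     (\<forall>A B. A \<subseteq> B \<longrightarrow>
        a * (F B - F A) \<le> (\<Sum>i\<in>B - A. F (A \<union> {i}) - F A) \<and>
        b * (F B - F A) \<ge> (\<Sum>i\<in>B - A. F B - F (B - {i})))"

end

theory Submission
  imports Defs
begin

text \<open>
  Write \<open>u\<^sub>i = x\<^sub>i / \<sigma>\<close> and \<open>M\<^sub>S = (\<Lambda>\<^sup>-\<^sup>1 + \<Sum>\<^sub>i\<^sub>\<in>\<^sub>S u\<^sub>i u\<^sub>i\<^sup>T)\<^sup>-\<^sup>1\<close>, so that
  \<open>F B - F A = tr M\<^sub>A - tr M\<^sub>B\<close>. Convexity of the trace of the inverse, linearized at both ends,
  gives
  \<open>\<Sum>\<^sub>i \<parallel>M\<^sub>B u\<^sub>i\<parallel>\<^sup>2 \<le> F B - F A \<le> \<Sum>\<^sub>i \<parallel>M\<^sub>A u\<^sub>i\<parallel>\<^sup>2\<close> with \<open>i\<close> ranging over \<open>B - A\<close>.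
  For a single added column \<open>u\<close>, Sherman--Morrison makes both bounds exact up to the factor
  \<open>k = 1 + u\<^sup>T M\<^sub>S u\<close>: the gain is \<open>\<parallel>M\<^sub>S u\<parallel>\<^sup>2 / k = k \<parallel>M\<^sub>S\<^sub>' u\<parallel>\<^sup>2\<close>, where \<open>S'\<close> is \<open>S\<close> together
  with the new column. Since \<open>M\<^sub>S \<le> \<Lambda>\<close>, the Rayleigh quotient bounds \<open>k\<close> by \<open>c\<close>.
\<close>

section \<open>Symmetric and positive definite matrices\<close>

lemma inner_symmetric_matrix:
  fixes A :: "real^'p^'p"
  assumes "transpose A = A"
  shows "x \<bullet> (A *v y) = (A *v x) \<bullet> y"
  by (metis assms dot_lmul_matrix transpose_matrix_vector)

lemma trace_eq_sum_axis:
  fixes A :: "real^'p^'p"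
  shows "trace A = (\<Sum>j\<in>UNIV. axis j 1 \<bullet> (A *v axis j 1))"
  by (simp add: trace_def inner_axis' matrix_vector_mul_component inner_axis)

text \<open>Parseval's identity for the standard basis, in the form in which the trace computations
  below meet it.\<close>

lemma sum_axis_inner_mult:
  fixes a b :: "real^'p"
  shows "(\<Sum>j\<in>UNIV. (a \<bullet> axis j 1) * (b \<bullet> axis j 1)) = a \<bullet> b"
  by (simp add: inner_axis) (simp add: inner_vec_def)

lemma sym_pos_def_symmetric: "sym_pos_def A \<Longrightarrow> transpose A = A"
  by (simp add: sym_pos_def_def)

lemma sym_pos_def_nonneg: "sym_pos_def A \<Longrightarrow> 0 \<le> v \<bullet> (A *v v)"
  by (cases "v = 0") (auto simp: sym_pos_def_def less_imp_le)

lemma sym_pos_def_invertible: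
  assumes "sym_pos_def A"
  shows "invertible A"
proof -
  have "\<forall>x. A *v x = 0 \<longrightarrow> x = 0"
    using assms by (metis inner_zero_right less_irrefl sym_pos_def_def)
  then show ?thesis
    using invertible_left_inverse matrix_left_invertible_ker by blast
qed

lemma
  fixes A :: "real^'p^'p"
  assumes "sym_pos_def A"
  shows sym_pos_def_mult_inv: "A *v (matrix_inv A *v x) = x"
    and sym_pos_def_inv_mult: "matrix_inv A *v (A *v x) = x"
proof -
  have "A ** matrix_inv A = mat 1 \<and> matrix_inv A ** A = mat 1"
    using sym_pos_def_invertible[OF assms] unfolding invertible_def matrix_inv_def
    by (rule someI_ex)
  then show "A *v (matrix_inv A *v x) = x" "matrix_inv A *v (A *v x) = x"
    by (simp_all add: matrix_vector_mul_assoc)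
qed

lemma symmetric_matrixI:
  fixes A :: "real^'p^'p"
  assumes "\<And>x y. x \<bullet> (A *v y) = (A *v x) \<bullet> y"
  shows "transpose A = A"
proof -
  have "transpose A *v x = A *v x" for x
    by (rule vector_eq_ldot[THEN iffD1]) (metis assms dot_lmul_matrix inner_commute transpose_matrix_vector)
  then show ?thesis
    by (simp add: matrix_eq)
qed

text \<open>Substituting \<open>v = A w\<close> turns the form of the inverse at \<open>v\<close>
  into the form of \<open>A\<close> at \<open>w\<close>.\<close>

lemma sym_pos_def_matrix_inv:
  fixes A :: "real^'p^'p"
  assumes "sym_pos_def A"
  shows "sym_pos_def (matrix_inv A)"
  unfolding sym_pos_def_def
proof (intro conjI allI impI)
  show "transpose (matrix_inv A) = matrix_inv A"
    by (rule symmetric_matrixI)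
      (metis assms inner_symmetric_matrix sym_pos_def_mult_inv sym_pos_def_symmetric)
next
  fix v :: "real^'p" assume "v \<noteq> 0"
  then have "matrix_inv A *v v \<noteq> 0"
    by (metis assms matrix_vector_mult_0_right sym_pos_def_mult_inv)
  then have "0 < (matrix_inv A *v v) \<bullet> (A *v (matrix_inv A *v v))"
    using assms by (simp add: sym_pos_def_def)
  then show "0 < v \<bullet> (matrix_inv A *v v)"
    by (simp add: sym_pos_def_mult_inv[OF assms] inner_commute)
qed

lemma matrix_inv_matrix_inv:
  fixes A :: "real^'p^'p"
  assumes "sym_pos_def A"
  shows "matrix_inv (matrix_inv A) = A"
  by (metis assms matrix_eq sym_pos_def_mult_inv sym_pos_def_inv_mult sym_pos_def_matrix_inv)

section \<open>Gram matrices of selected columns\<close>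

lemma col_gram_mult:
  "col_gram X S *v v = (\<Sum>i\<in>S. (column i X \<bullet> v) *\<^sub>R column i X)"
proof -
  have "(\<Sum>k\<in>UNIV. (\<Sum>i\<in>S. X $ j $ i * X $ k $ i) * v $ k)
      = (\<Sum>i\<in>S. (\<Sum>k\<in>UNIV. X $ k $ i * v $ k) * X $ j $ i)" for j
    by (subst sum_distrib_right, subst sum.swap) (simp add: sum_distrib_left sum_distrib_right mult_ac)
  then show ?thesis
    by (simp add: vec_eq_iff matrix_vector_mult_def col_gram_def column_def inner_vec_def)
qed

lemma col_gram_quadratic_form:
  "v \<bullet> (col_gram X S *v v) = (\<Sum>i\<in>S. (column i X \<bullet> v)\<^sup>2)"
  by (simp add: col_gram_mult inner_sum_right power2_eq_square inner_commute)

text \<open>Allows the noise factor to be absorbed into the columns.\<close>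

lemma col_gram_scaleR: "col_gram (a *\<^sub>R X) S = a\<^sup>2 *\<^sub>R col_gram X S"
  by (simp add: col_gram_def vec_eq_iff sum_distrib_left power2_eq_square mult_ac)

lemma col_gram_Un_disjoint:
  fixes X :: "real^'n^'p"
  assumes "S \<inter> T = {}"
  shows "col_gram X (S \<union> T) = col_gram X S + col_gram X T"
  by (simp add: col_gram_def vec_eq_iff sum.union_disjoint assms)

lemma sym_pos_def_add_col_gram:
  fixes P :: "real^'p^'p"
  assumes "sym_pos_def P"
  shows "sym_pos_def (P + col_gram X S)"
proof -
  have "transpose (col_gram X S) = col_gram X S"
    by (simp add: col_gram_def transpose_def vec_eq_iff mult.commute)
  then have "transpose (P + col_gram X S) = P + col_gram X S"
    using sym_pos_def_symmetric[OF assms] by (simp add: transpose_def vec_eq_iff)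
  moreover have "0 < v \<bullet> ((P + col_gram X S) *v v)" if "v \<noteq> 0" for v
    using assms that
    by (simp add: sym_pos_def_def matrix_vector_mult_add_rdistrib inner_add_right
        col_gram_quadratic_form add_pos_nonneg sum_nonneg)
  ultimately show ?thesis
    by (simp add: sym_pos_def_def)
qed

section \<open>Effect of adding columns on the trace of the inverse\<close>

text \<open>
  The difference of the two sides is \<open>z \<bullet> Q z\<close> with \<open>z = P\<^sup>-\<^sup>1 x - Q\<^sup>-\<^sup>1 x\<close>; the matrices \<open>P\<close> and
  \<open>Q\<close> need not be comparable, so the bound can be used in both directions.
\<close>
lemma matrix_inv_quadratic_form_diff_le:
  fixes P Q :: "real^'p^'p"
  assumes P: "sym_pos_def P" and Q: "sym_pos_def Q"
  shows "x \<bullet> (matrix_inv P *v x) - x \<bullet> (matrix_inv Q *v x)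
    \<le> (matrix_inv P *v x) \<bullet> ((Q - P) *v (matrix_inv P *v x))"
proof -
  define y z where "y = matrix_inv P *v x" and "z = matrix_inv Q *v x"
  have Py: "P *v y = x" and Qz: "Q *v z = x"
    by (simp_all add: y_def z_def sym_pos_def_mult_inv P Q)
  have "z \<bullet> (Q *v y) = x \<bullet> y"
    using inner_symmetric_matrix[OF sym_pos_def_symmetric[OF Q]] Qz by metis
  moreover have "0 \<le> (y - z) \<bullet> (Q *v (y - z))"
    by (rule sym_pos_def_nonneg[OF Q])
  ultimately have "x \<bullet> y - x \<bullet> z \<le> y \<bullet> ((Q - P) *v y)"
    by (simp add: Py Qz matrix_vector_mult_diff_distrib matrix_vector_mult_diff_rdistrib
        inner_diff_left inner_diff_right inner_commute)
  then show ?thesis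
    by (simp add: y_def z_def)
qed

text \<open>Each form is a sum of squares; symmetry moves \<open>N\<close> from the axis vector onto
  the column, and after exchanging the sums Parseval's identity produces the norms.\<close>

lemma sum_axis_col_gram_quadratic_form:
  fixes N :: "real^'p^'p"
  assumes "transpose N = N"
  shows "(\<Sum>j\<in>UNIV. (N *v axis j 1) \<bullet> (col_gram X D *v (N *v axis j 1)))
    = (\<Sum>i\<in>D. (norm (N *v column i X))\<^sup>2)"
proof -
  have "(\<Sum>j\<in>UNIV. (N *v axis j 1) \<bullet> (col_gram X D *v (N *v axis j 1)))
      = (\<Sum>i\<in>D. \<Sum>j\<in>UNIV. ((N *v column i X) \<bullet> axis j 1) * ((N *v column i X) \<bullet> axis j 1))"
    by (subst sum.swap)
      (simp add: col_gram_quadratic_form inner_symmetric_matrix[OF assms] power2_eq_square)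
  then show ?thesis
    by (simp only: sum_axis_inner_mult power2_norm_eq_inner)
qed

text \<open>The two trace bounds come from the preceding linearization applied to
  \<open>(P, Q)\<close> and to \<open>(Q, P)\<close>, summed over the standard basis. The last
  inequality follows from the second application, since the Gram form is nonnegative.\<close>

lemma
  fixes P :: "real^'p^'p" and X :: "real^'n^'p" and D :: "'n set"
  assumes P: "sym_pos_def P"
  defines "Q \<equiv> P + col_gram X D"
  shows trace_inv_add_col_gram_upper:
      "trace (matrix_inv P) - trace (matrix_inv Q) \<le> (\<Sum>i\<in>D. (norm (matrix_inv P *v column i X))\<^sup>2)"
    and trace_inv_add_col_gram_lower:
      "(\<Sum>i\<in>D. (norm (matrix_inv Q *v column i X))\<^sup>2) \<le> trace (matrix_inv P) - trace (matrix_inv Q)"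
    and inv_add_col_gram_quadratic_form_le:
      "x \<bullet> (matrix_inv Q *v x) \<le> x \<bullet> (matrix_inv P *v x)"
proof -
  have Q: "sym_pos_def Q"
    unfolding Q_def by (rule sym_pos_def_add_col_gram[OF P])
  have up: "x \<bullet> (matrix_inv P *v x) - x \<bullet> (matrix_inv Q *v x)
      \<le> (matrix_inv P *v x) \<bullet> (col_gram X D *v (matrix_inv P *v x))" for x
    using matrix_inv_quadratic_form_diff_le[OF P Q] by (simp add: Q_def)
  have "P - Q = - col_gram X D"
    by (simp add: Q_def)
  then have "(P - Q) *v y = - (col_gram X D *v y)" for y
    by (metis diff_0 matrix_vector_mult_0 matrix_vector_mult_diff_rdistrib)
  then have low: "(matrix_inv Q *v x) \<bullet> (col_gram X D *v (matrix_inv Q *v x))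
      \<le> x \<bullet> (matrix_inv P *v x) - x \<bullet> (matrix_inv Q *v x)" for x
    using matrix_inv_quadratic_form_diff_le[OF Q P, of x] by simp
  have tr: "trace (matrix_inv P) - trace (matrix_inv Q)
      = (\<Sum>j\<in>UNIV. axis j 1 \<bullet> (matrix_inv P *v axis j 1) - axis j 1 \<bullet> (matrix_inv Q *v axis j 1))"
    by (simp add: trace_eq_sum_axis sum_subtractf)
  note sym = sym_pos_def_symmetric[OF sym_pos_def_matrix_inv]
  show "trace (matrix_inv P) - trace (matrix_inv Q) \<le> (\<Sum>i\<in>D. (norm (matrix_inv P *v column i X))\<^sup>2)"
    unfolding tr sum_axis_col_gram_quadratic_form[OF sym[OF P], symmetric]
    by (rule sum_mono) (rule up)
  show "(\<Sum>i\<in>D. (norm (matrix_inv Q *v column i X))\<^sup>2) \<le> trace (matrix_inv P) - trace (matrix_inv Q)"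
    unfolding tr sum_axis_col_gram_quadratic_form[OF sym[OF Q], symmetric]
    by (rule sum_mono) (rule low)
  have "0 \<le> (matrix_inv Q *v x) \<bullet> (col_gram X D *v (matrix_inv Q *v x))"
    by (simp add: col_gram_quadratic_form sum_nonneg)
  with low show "x \<bullet> (matrix_inv Q *v x) \<le> x \<bullet> (matrix_inv P *v x)"
    by (smt (verit))
qed

lemma
  fixes P :: "real^'p^'p" and X :: "real^'n^'p" and i :: 'n
  assumes P: "sym_pos_def P"
  defines "u \<equiv> column i X" and "Q \<equiv> P + col_gram X {i}"
  shows trace_inv_add_rank_one:
      "trace (matrix_inv P) - trace (matrix_inv Q)
        = (norm (matrix_inv P *v u))\<^sup>2 / (1 + u \<bullet> (matrix_inv P *v u))"
    and trace_inv_add_rank_one':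
      "trace (matrix_inv P) - trace (matrix_inv Q)
        = (1 + u \<bullet> (matrix_inv P *v u)) * (norm (matrix_inv Q *v u))\<^sup>2"
proof -
  define k where "k = 1 + u \<bullet> (matrix_inv P *v u)"
  have Q: "sym_pos_def Q"
    unfolding Q_def by (rule sym_pos_def_add_col_gram[OF P])
  have k: "k > 0"
    using sym_pos_def_nonneg[OF sym_pos_def_matrix_inv[OF P], of u] by (simp add: k_def)
  \<comment> \<open>Sherman--Morrison in vector form: \<open>Q\<close> applied to
    \<open>matrix_inv P *v x\<close> exceeds \<open>x\<close> by a multiple of \<open>u\<close>
    only, and inverting \<open>Q\<close> isolates the difference.\<close>
  have diff: "matrix_inv P *v x - matrix_inv Q *v x
      = (u \<bullet> (matrix_inv P *v x)) *\<^sub>R (matrix_inv Q *v u)" for x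
  proof -
    have "Q *v (matrix_inv P *v x) = x + (u \<bullet> (matrix_inv P *v x)) *\<^sub>R u"
      by (simp add: Q_def matrix_vector_mult_add_rdistrib sym_pos_def_mult_inv[OF P]
          col_gram_mult u_def)
    then have "matrix_inv P *v x
        = matrix_inv Q *v (x + (u \<bullet> (matrix_inv P *v x)) *\<^sub>R u)"
      by (metis Q sym_pos_def_inv_mult)
    then show ?thesis
      by (simp only: matrix_vector_right_distrib matrix_vector_mult_scaleR add_diff_cancel_left'
          diff_eq_eq add.commute)
  qed
  \<comment> \<open>The case \<open>x = u\<close>: the two inverses send \<open>u\<close> to
    parallel vectors with ratio \<open>k\<close>, so the mixed inner product \<open>tr\<close> can
    be written with either norm.\<close>
  have Pu: "matrix_inv P *v u = k *\<^sub>R (matrix_inv Q *v u)"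
    using diff[of u] by (simp add: k_def scaleR_add_left algebra_simps)
  have "trace (matrix_inv P) - trace (matrix_inv Q)
      = (\<Sum>j\<in>UNIV. axis j 1 \<bullet> (matrix_inv P *v axis j 1 - matrix_inv Q *v axis j 1))"
    by (simp add: trace_eq_sum_axis sum_subtractf inner_diff_right)
  also have "\<dots> = (\<Sum>j\<in>UNIV. ((matrix_inv P *v u) \<bullet> axis j 1) * ((matrix_inv Q *v u) \<bullet> axis j 1))"
  proof (rule sum.cong)
    fix j :: 'p
    show "axis j 1 \<bullet> (matrix_inv P *v axis j 1 - matrix_inv Q *v axis j 1)
        = ((matrix_inv P *v u) \<bullet> axis j 1) * ((matrix_inv Q *v u) \<bullet> axis j 1)"
      unfolding diff inner_scaleR_right
      by (simp only: inner_symmetric_matrix[OF sym_pos_def_symmetric[OF sym_pos_def_matrix_inv[OF P]]]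
          inner_commute[of "axis j 1" "matrix_inv Q *v u"])
  qed simp
  also have "\<dots> = (matrix_inv P *v u) \<bullet> (matrix_inv Q *v u)"
    by (rule sum_axis_inner_mult)
  finally have tr: "trace (matrix_inv P) - trace (matrix_inv Q) = \<dots>" .
  show "trace (matrix_inv P) - trace (matrix_inv Q)
      = (norm (matrix_inv P *v u))\<^sup>2 / (1 + u \<bullet> (matrix_inv P *v u))"
    unfolding tr k_def[symmetric] using k
    by (simp add: Pu power_mult_distrib power2_eq_square[of k] power2_norm_eq_inner)
  show "trace (matrix_inv P) - trace (matrix_inv Q)
      = (1 + u \<bullet> (matrix_inv P *v u)) * (norm (matrix_inv Q *v u))\<^sup>2"
    unfolding tr k_def[symmetric]
    by (simp add: Pu power2_norm_eq_inner)
qed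

section \<open>The largest eigenvalue and the Rayleigh quotient\<close>

text \<open>Eigenvectors for distinct eigenvalues are orthogonal, and an orthogonal family is
  finite. This makes the \<open>Max\<close> in \<open>lambda_max\<close> a genuine maximum.\<close>

lemma finite_eigenvalues_symmetric:
  fixes A :: "real^'p^'p"
  assumes "transpose A = A"
  shows "finite (eigenvalues A)"
proof -
  define f where "f \<mu> = (SOME v. v \<noteq> 0 \<and> A *v v = \<mu> *\<^sub>R v)" for \<mu>
  have f: "f \<mu> \<noteq> 0 \<and> A *v f \<mu> = \<mu> *\<^sub>R f \<mu>" if "\<mu> \<in> eigenvalues A" for \<mu>
    using that unfolding eigenvalues_def f_def mem_Collect_eq by (rule someI_ex)
  have orth: "f \<mu> \<bullet> f \<nu> = 0" if "\<mu> \<in> eigenvalues A" "\<nu> \<in> eigenvalues A" "\<mu> \<noteq> \<nu>" for \<mu> \<nu>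
  proof -
    have "f \<mu> \<bullet> (A *v f \<nu>) = (A *v f \<mu>) \<bullet> f \<nu>"
      by (rule inner_symmetric_matrix[OF assms])
    then show ?thesis
      using f that by simp
  qed
  then have "pairwise orthogonal (f ` eigenvalues A)"
    by (auto simp: pairwise_def orthogonal_def)
  then have "finite (f ` eigenvalues A)"
    by (rule pairwise_orthogonal_imp_finite)
  moreover have "inj_on f (eigenvalues A)"
    by (metis (no_types, lifting) f inj_onI inner_eq_zero_iff orth)
  ultimately show ?thesis
    by (rule finite_imageD)
qed

text \<open>By compactness the form attains its maximum on the unit sphere, and a maximizer is an
  eigenvector, so the maximum is an eigenvalue.\<close>

lemma quadratic_form_le_lambda_max:
  fixes A :: "real^'p^'p"
  assumes sym: "transpose A = A"
  shows "x \<bullet> (A *v x) \<le> lambda_max A * (norm x)\<^sup>2"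
proof -
  have "sphere (0 :: real^'p) 1 \<noteq> {}"
    by simp
  moreover have "continuous_on (sphere 0 1) (\<lambda>v. v \<bullet> (A *v v))"
    by (intro continuous_intros)
  ultimately have "\<exists>v\<in>sphere 0 1. \<forall>w\<in>sphere 0 1. w \<bullet> (A *v w) \<le> v \<bullet> (A *v v)"
    by (rule continuous_attains_sup[OF compact_sphere])
  then obtain v where v: "norm v = 1"
    and max: "\<And>w. norm w = 1 \<Longrightarrow> w \<bullet> (A *v w) \<le> v \<bullet> (A *v v)"
    by auto
  define \<mu> where "\<mu> = v \<bullet> (A *v v)"
  have ray: "w \<bullet> (A *v w) \<le> \<mu> * (norm w)\<^sup>2" for w
  proof (cases "w = 0")
    case False
    then have "(w /\<^sub>R norm w) \<bullet> (A *v (w /\<^sub>R norm w)) \<le> \<mu>"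
      unfolding \<mu>_def by (intro max) simp
    with False show ?thesis
      by (simp add: matrix_vector_mult_scaleR field_simps power2_eq_square)
  qed simp
  \<comment> \<open>\<open>\<mu> I - A\<close> is positive semidefinite and its form vanishes at \<open>v\<close>; perturbing \<open>v\<close> in the
    direction \<open>w = A v - \<mu> v\<close> would make it negative unless \<open>w = 0\<close>.\<close>
  define w where "w = A *v v - \<mu> *\<^sub>R v"
  define a where "a = \<mu> * (w \<bullet> w) - w \<bullet> (A *v w)"
  have pert: "2 * t * (w \<bullet> w) \<le> t\<^sup>2 * a" for t
  proof -
    have "v \<bullet> (A *v w) = w \<bullet> (A *v v)"
      by (metis inner_symmetric_matrix[OF sym] inner_commute)
    moreover have "v \<bullet> v = 1"
      using v by (simp add: norm_eq_1)
    moreover have "w \<bullet> (A *v v) = w \<bullet> w + \<mu> * (w \<bullet> v)"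
      by (subst (3) w_def) (simp add: inner_diff_right)
    moreover have "(v + t *\<^sub>R w) \<bullet> (A *v (v + t *\<^sub>R w)) \<le> \<mu> * ((v + t *\<^sub>R w) \<bullet> (v + t *\<^sub>R w))"
      using ray by (simp add: power2_norm_eq_inner)
    ultimately show ?thesis
      by (simp add: a_def matrix_vector_right_distrib matrix_vector_mult_scaleR inner_add_left
          inner_add_right \<mu>_def[symmetric] inner_commute[of v w] power2_eq_square algebra_simps)
  qed
  have "w \<bullet> w = 0"
  proof (rule ccontr)
    assume "w \<bullet> w \<noteq> 0"
    then have pos: "w \<bullet> w > 0"
      by (metis inner_ge_zero less_le)
    have "a \<ge> 0"
      using ray[of w] by (simp add: a_def power2_norm_eq_inner)
    \<comment> \<open>With this \<open>t\<close>, \<open>t * a = w \<bullet> w - t\<close> is less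
      than \<open>w \<bullet> w\<close>, contradicting \<open>pert\<close>; the \<open>+ 1\<close>
      keeps the denominator positive when \<open>a = 0\<close>.\<close>
    define t where "t = (w \<bullet> w) / (a + 1)"
    have t: "t > 0" "t * (a + 1) = w \<bullet> w"
      using pos \<open>a \<ge> 0\<close> by (simp_all add: t_def)
    have "t * (2 * (w \<bullet> w)) \<le> t * (t * a)"
      using pert[of t] by (simp add: power2_eq_square algebra_simps)
    then have "2 * (w \<bullet> w) \<le> t * a"
      using t(1) by simp
    then show False
      using t pos by (simp add: algebra_simps)
  qed
  then have "A *v v = \<mu> *\<^sub>R v"
    by (simp add: w_def)
  moreover have "v \<noteq> 0"
    using v by auto
  ultimately have "\<mu> \<in> eigenvalues A"
    by (auto simp: eigenvalues_def)
  then have "\<mu> \<le> lambda_max A"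
    unfolding lambda_max_def by (intro Max_ge finite_eigenvalues_symmetric sym)
  then show ?thesis
    using ray[of x] mult_right_mono[of \<mu> "lambda_max A" "(norm x)\<^sup>2"] by simp
qed

lemma lambda_max_pos:
  fixes A :: "real^'p^'p"
  assumes "sym_pos_def A"
  shows "0 < lambda_max A"
proof -
  obtain v :: "real^'p" where v: "norm v = 1"
    using vector_choose_size[of 1] by auto
  then have "v \<noteq> 0"
    by auto
  then have "0 < v \<bullet> (A *v v)"
    using assms by (simp add: sym_pos_def_def)
  also have "\<dots> \<le> lambda_max A * (norm v)\<^sup>2"
    by (rule quadratic_form_le_lambda_max[OF sym_pos_def_symmetric[OF assms]])
  finally show ?thesis
    by (simp add: v)
qed

section \<open>Weak submodularity of the design objective\<close>

theorem theorem6: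
  fixes X :: "real^'n^'p" and \<sigma> s c :: real and \<Lambda> :: "real^'p^'p"
  assumes "\<sigma> > 0"
    and "sym_pos_def \<Lambda>"
    and "s = Max (range (\<lambda>i. norm (column i X)))"
    and "c = 1 + s\<^sup>2 / \<sigma>\<^sup>2 * lambda_max \<Lambda>"
  shows "weakly_submodular (1 / c) c (bayes_A_opt X \<sigma> \<Lambda>)"
proof -
  define Y where "Y = (1 / \<sigma>) *\<^sub>R X"
  define K where "K S = matrix_inv \<Lambda> + col_gram Y S" for S
  define u where "u i = column i Y" for i
  define F where "F = bayes_A_opt X \<sigma> \<Lambda>"
  have F: "F S = trace \<Lambda> - trace (matrix_inv (K S))" for S
    by (simp add: F_def bayes_A_opt_def K_def Y_def col_gram_scaleR power_divide)
  have K: "sym_pos_def (K S)" for S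
    unfolding K_def by (intro sym_pos_def_add_col_gram sym_pos_def_matrix_inv assms)
  have K_Un: "K (S \<union> T) = K S + col_gram Y T" if "S \<inter> T = {}" for S T
    using that by (simp add: K_def col_gram_Un_disjoint add.assoc)
  define k where "k S i = 1 + u i \<bullet> (matrix_inv (K S) *v u i)" for S i
  have k_ge: "1 \<le> k S i" for S i
    using sym_pos_def_nonneg[OF sym_pos_def_matrix_inv[OF K]] by (simp add: k_def)
  have k_le: "k S i \<le> c" for S i
  proof -
    \<comment> \<open>\<open>K S\<close> arises from \<open>matrix_inv \<Lambda>\<close> by adding a
      Gram matrix, so its inverse is dominated by the double inverse, which is
      \<open>\<Lambda>\<close>.\<close>
    have "u i \<bullet> (matrix_inv (K S) *v u i) \<le> u i \<bullet> (\<Lambda> *v u i)"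
      using inv_add_col_gram_quadratic_form_le[OF sym_pos_def_matrix_inv[OF assms(2)]]
      by (simp add: K_def matrix_inv_matrix_inv[OF assms(2)])
    also have "\<dots> \<le> lambda_max \<Lambda> * (norm (u i))\<^sup>2"
      by (intro quadratic_form_le_lambda_max sym_pos_def_symmetric assms)
    also have "\<dots> \<le> lambda_max \<Lambda> * (s\<^sup>2 / \<sigma>\<^sup>2)"
    proof -
      have "u i = (1 / \<sigma>) *\<^sub>R column i X"
        by (simp add: u_def Y_def column_def vec_eq_iff)
      then have "norm (u i) = norm (column i X) / \<sigma>"
        using \<open>\<sigma> > 0\<close> by simp
      also have "\<dots> \<le> s / \<sigma>"
        using \<open>\<sigma> > 0\<close> by (intro divide_right_mono) (auto simp: assms(3))
      finally have "(norm (u i))\<^sup>2 \<le> (s / \<sigma>)\<^sup>2"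
        by (rule power_mono) simp
      then show ?thesis
        using lambda_max_pos[OF assms(2)] by (intro mult_left_mono) (simp_all add: power_divide)
    qed
    finally show ?thesis
      by (simp add: k_def assms(4) mult.commute)
  qed
  have c: "1 \<le> c"
    using k_ge k_le order_trans by blast
  have "1 / c * (F B - F A) \<le> (\<Sum>i\<in>B - A. F (A \<union> {i}) - F A)
      \<and> (\<Sum>i\<in>B - A. F B - F (B - {i})) \<le> c * (F B - F A)" if "A \<subseteq> B" for A B
  proof
    have KB: "K B = K A + col_gram Y (B - A)"
      using K_Un[of A "B - A"] that by (simp add: Un_absorb1)
    \<comment> \<open>Linearizing at \<open>A\<close> leaves the same terms as the single gains from
      \<open>A\<close>, up to the factor \<open>k A i\<close>, which is at most
      \<open>c\<close>.\<close>
    have "1 / c * (F B - F A) \<le> 1 / c * (\<Sum>i\<in>B - A. (norm (matrix_inv (K A) *v u i))\<^sup>2)"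
      using trace_inv_add_col_gram_upper[OF K[of A], where X = Y and D = "B - A"] c
      by (intro mult_left_mono) (simp_all add: F KB u_def)
    also have "\<dots> \<le> (\<Sum>i\<in>B - A. F (A \<union> {i}) - F A)"
      unfolding sum_distrib_left
    proof (rule sum_mono)
      fix i assume i: "i \<in> B - A"
      then have "F (A \<union> {i}) - F A = (norm (matrix_inv (K A) *v u i))\<^sup>2 / k A i"
        using trace_inv_add_rank_one[OF K[of A], where X = Y and i = i] K_Un[of A "{i}"] by (simp add: F u_def k_def)
      moreover have "(norm (matrix_inv (K A) *v u i))\<^sup>2 / c \<le> (norm (matrix_inv (K A) *v u i))\<^sup>2 / k A i"
        using k_ge[of A i] k_le[of A i] by (intro divide_left_mono) auto
      ultimately show "1 / c * (norm (matrix_inv (K A) *v u i))\<^sup>2 \<le> F (A \<union> {i}) - F A"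
        by simp
    qed
    finally show "1 / c * (F B - F A) \<le> (\<Sum>i\<in>B - A. F (A \<union> {i}) - F A)" .
    \<comment> \<open>The update now runs from \<open>B - {i}\<close> to \<open>B\<close>. The
      second rank-one formula expresses every loss through \<open>matrix_inv (K B)\<close>, matching
      the linearization at \<open>B\<close>.\<close>
    have "(\<Sum>i\<in>B - A. F B - F (B - {i})) \<le> c * (\<Sum>i\<in>B - A. (norm (matrix_inv (K B) *v u i))\<^sup>2)"
      unfolding sum_distrib_left
    proof (rule sum_mono)
      fix i assume i: "i \<in> B - A"
      then have "K B = K (B - {i}) + col_gram Y {i}"
        using K_Un[of "B - {i}" "{i}"] by (simp add: insert_absorb)
      then have "F B - F (B - {i}) = k (B - {i}) i * (norm (matrix_inv (K B) *v u i))\<^sup>2"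
        using trace_inv_add_rank_one'[OF K[of "B - {i}"], where X = Y and i = i] by (simp add: F u_def k_def)
      then show "F B - F (B - {i}) \<le> c * (norm (matrix_inv (K B) *v u i))\<^sup>2"
        using k_le by (simp add: mult_right_mono)
    qed
    also have "\<dots> \<le> c * (F B - F A)"
      using trace_inv_add_col_gram_lower[OF K[of A], where X = Y and D = "B - A"] c
      by (intro mult_left_mono) (simp_all add: F KB u_def)
    finally show "(\<Sum>i\<in>B - A. F B - F (B - {i})) \<le> c * (F B - F A)" .
  qed
  then show ?thesis
    unfolding weakly_submodular_def F_def by blast
qed

end
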